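(* For each $n\in\mathcal{N}^+$ let $J_n$ be the maximizer of $R_n$ over $[0,M_n]$, let $K^*=\sum_{n\in\mathcal{N}^+}J_n$, and for $0\le K\le\sum_{n\in\mathcal{N}^+}M_n$ let $R(K)$ denote the optimal objective value of the relaxed Problem (P4) with total load $K$ (all defined in the context). Let $\mathbf{y}^*=(y_0^*,\dots,y_N^* )$ denote an optimal solution of the relaxed Problem (P4) with total load $K$. Then the following properties hold: Property 1: If $K=K^*$, the optimal load distribution is $y_n^*=J_n$ for all $n\in\mathcal{N}^+$. Property 2: If $K<K^*$, then $y_n^*\le J_n$ for all $n\in\mathcal{N}^+$, and the objective $R$ is strictly concave in $0\le y_n\le J_n$, for all $n\in\mathcal{N}^+$. Property 3: If $K>K^*$, then $y_n^*\ge J_n$ for all $n\in\mathcal{N}^+$. Property 4: $R(K)$ is monotonically increasing in $0\le K\le K^*$, and $R(K^* )>R(K)$ for all $K>K^*$.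
   Context: Let $\mathcal{N}^+=\{0,1,\dots,N\}$. Given are reals $r_n>0$, $f_n>0$, $d_n>0$, $c_n\ge 0$ for $n\in\mathcal{N}^+$ with $c_0=0$, a real $\lambda\ge 0$, and positive integers $M_n$. Define for $y\ge 0$ $$R_n(y)=\frac{y}{\frac{1}{r_n}+\frac{(1+d_n)^{y-1}}{f_n}}-\lambda y c_n .$$ The relaxed Problem (P4) with total load $K$ (a real number; feasible when $0\le K\le \sum_{n\in\mathcal{N}^+} M_n$) is: maximize $R(\mathbf{y})=\sum_{n\in\mathcal{N}^+}R_n(y_n)$ over $\mathbf{y}\in\mathbb{R}^{N+1}$ subject to $\sum_{n\in\mathcal{N}^+}y_n=K$ and $0\le y_n\le M_n$ for all $n\in\mathcal{N}^+$. The one-sided optimal load is $J_n=\operatorname{argmax}_{0\le y\le M_n}R_n(y)$. Equivalently, $J_n=\min\{J_n',M_n\}$ if $\lambda c_n\le 1/\big[\frac{1}{r_n}+\frac{1}{f_n(1+d_n)}\big]$ and $J_n=0$ otherwise, where $J_n'\ge 0$ is the root in $y$ of $$\frac{1}{r_n}+\frac{(1+d_n)^{y-1}}{f_n}\left[1-y\ln(1+d_n)\right]=\lambda c_n\left[\frac{1}{r_n}+\frac{(1+d_n)^{y-1}}{f_n}\right]^2 .$$ *)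

theory Defs
  imports "HOL-Analysis.Analysis"
begin

definition node_reward :: "real \<Rightarrow> real \<Rightarrow> real \<Rightarrow> real \<Rightarrow> real \<Rightarrow> real \<Rightarrow> real" where
  "node_reward lam r f d c y = y / (1 / r + (1 + d) powr (y - 1) / f) - lam * y * c"

text \<open>
  The nodes are the elements of a finite type \<^typ>\<open>'n\<close>, so that load vectors live in the
  Euclidean space \<^typ>\<open>real ^ 'n\<close>. Below, \<open>G n\<close> is the reward function of node \<open>n\<close>
  and \<open>M n\<close> its capacity.
\<close>

definition objective :: "('n::finite \<Rightarrow> real \<Rightarrow> real) \<Rightarrow> real ^ 'n \<Rightarrow> real" where
  "objective G y = (\<Sum>n\<in>UNIV. G n (y $ n))"

definition feasible :: "('n::finite \<Rightarrow> nat) \<Rightarrow> real \<Rightarrow> (real ^ 'n) set" where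
  "feasible M K = {y. (\<Sum>n\<in>UNIV. y $ n) = K \<and> (\<forall>n. 0 \<le> y $ n \<and> y $ n \<le> real (M n))}"

definition optimal_solution ::
    "('n::finite \<Rightarrow> real \<Rightarrow> real) \<Rightarrow> ('n \<Rightarrow> nat) \<Rightarrow> real \<Rightarrow> real ^ 'n \<Rightarrow> bool" where
  "optimal_solution G M K y \<longleftrightarrow> is_arg_max (objective G) (\<lambda>x. x \<in> feasible M K) y"

definition optimal_value :: "('n::finite \<Rightarrow> real \<Rightarrow> real) \<Rightarrow> ('n \<Rightarrow> nat) \<Rightarrow> real \<Rightarrow> real" where
  "optimal_value G M K = (SUP y\<in>feasible M K. objective G y)"

lemma optimal_value_eq:
  assumes "optimal_solution G M K y"
  shows "optimal_value G M K = objective G y"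
  using assms unfolding optimal_value_def optimal_solution_def is_arg_max_def
  by (intro cSup_eq_maximum) (auto simp: not_less)

definition one_sided_load :: "('n \<Rightarrow> real \<Rightarrow> real) \<Rightarrow> ('n \<Rightarrow> nat) \<Rightarrow> 'n \<Rightarrow> real" where
  "one_sided_load G M n = arg_max_on (G n) {0..real (M n)}"

definition strictly_concave_on :: "'a::real_vector set \<Rightarrow> ('a \<Rightarrow> real) \<Rightarrow> bool" where
  "strictly_concave_on S F \<longleftrightarrow> convex S \<and>
     (\<forall>x\<in>S. \<forall>y\<in>S. x \<noteq> y \<longrightarrow>
        (\<forall>t. 0 < t \<and> t < 1 \<longrightarrow>
           (1 - t) * F x + t * F y < F ((1 - t) *\<^sub>R x + t *\<^sub>R y)))"

end

theory Submission
  imports Defs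
begin

text \<open>
  With \<open>a = 1 / r\<close>, \<open>s = ln (1 + d)\<close>, \<open>b = 1 / (f (1 + d))\<close> the reward is
  \<open>y / (a + b e\<^sup>s\<^sup>y) - \<lambda> c y\<close>, whose derivative is \<open>N / D\<^sup>2 - \<lambda> c\<close> with
  \<open>N = a + b e\<^sup>s\<^sup>y (1 - s y)\<close> strictly decreasing and \<open>D = a + b e\<^sup>s\<^sup>y\<close> strictly increasing.
  Hence the derivative is strictly decreasing to the left of any point where it is nonnegative, so
  each reward is strictly increasing and strictly concave up to its maximizer \<open>J\<close> and strictly
  decreasing afterwards. Given that, a feasible load with one coordinate on the wrong side of \<open>J\<close>
  is strictly improved by shifting some load between two coordinates, both of them towards \<open>J\<close>.
\<close>

section \<open>Real functions and the sign and monotonicity of their derivative\<close>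

lemma strictly_concave_on_if_deriv_decreasing:
  fixes g g' :: "real \<Rightarrow> real"
  assumes deriv: "\<And>y. (g has_real_derivative g' y) (at y)"
    and decr: "strict_antimono_on {l..u} g'"
  shows "strictly_concave_on {l..u} g"
proof -
  have chord: "(1 - t) * g x + t * g y < g ((1 - t) * x + t * y)"
    if "x \<in> {l..u}" "y \<in> {l..u}" "x < y" "0 < t" "t < 1" for x y t
  proof -
    define z where "z = (1 - t) * x + t * y"
    have zx: "z - x = t * (y - x)" and yz: "y - z = (1 - t) * (y - x)"
      by (simp_all add: z_def algebra_simps)
    have "0 < z - x" "0 < y - z"
      unfolding zx yz using that by simp_all
    then have "x < z" "z < y" by simp_all
    obtain v where v: "x < v" "v < z" "g z - g x = (z - x) * g' v"
      using MVT2[OF \<open>x < z\<close> deriv] by blast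
    obtain w where w: "z < w" "w < y" "g y - g z = (y - z) * g' w"
      using MVT2[OF \<open>z < y\<close> deriv] by blast
    have "g' w < g' v"
      using decr v(1,2) w(1,2) that by (intro monotone_onD[OF decr]) auto
    \<comment> \<open>This product is exactly the height of \<open>g z\<close> above the chord: the
      two mean value slopes are weighted by \<open>z - x = t * (y - x)\<close> and
      \<open>y - z = (1 - t) * (y - x)\<close>.\<close>
    then have "0 < t * (1 - t) * (y - x) * (g' v - g' w)"
      using that by simp
    also have "\<dots> = (1 - t) * (g z - g x) - t * (g y - g z)"
      by (simp add: v(3) w(3) zx yz algebra_simps)
    finally show ?thesis
      by (simp add: z_def algebra_simps)
  qed
  show ?thesis
    unfolding strictly_concave_on_def
  proof (intro conjI ballI impI allI)
    fix x y t assume xy: "x \<in> {l..u}" "y \<in> {l..u}" "x \<noteq> y" and t: "0 < t \<and> t < (1::real)"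
    consider "x < y" | "y < x" using xy(3) by linarith
    then show "(1 - t) * g x + t * g y < g ((1 - t) *\<^sub>R x + t *\<^sub>R y)"
    proof cases
      case 1
      then show ?thesis using chord[of x y t] xy t by simp
    next
      case 2
      then show ?thesis using chord[of y x "1 - t"] xy t by (simp add: add.commute)
    qed
  qed simp
qed

text \<open>Optimality of \<open>J\<close> gives \<open>g' J \<ge> 0\<close> if \<open>J\<close> can
  be decreased and \<open>g' J \<le> 0\<close> if it can be increased. By \<open>decr\<close> the
  first sign spreads to the left as strict positivity, and a nonnegative value to the right of
  \<open>J\<close> would contradict the second.\<close>

lemma unimodal_at_maximizer:
  fixes g g' :: "real \<Rightarrow> real"
  assumes deriv: "\<And>y. (g has_real_derivative g' y) (at y)"
    and decr: "\<And>x y. 0 \<le> y \<Longrightarrow> y < x \<Longrightarrow> 0 \<le> g' x \<Longrightarrow> g' x < g' y"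
    and J: "J \<in> {0..m}" and max: "\<And>y. y \<in> {0..m} \<Longrightarrow> g y \<le> g J"
  shows "strict_mono_on {0..J} g" "strict_antimono_on {J..m} g" "strictly_concave_on {0..J} g"
proof -
  have cont: "continuous_on S g" for S
    using deriv by (meson DERIV_isCont continuous_at_imp_continuous_on)
  have left: "0 \<le> g' J" if "0 < J"
  proof (rule ccontr)
    assume "\<not> 0 \<le> g' J"
    then obtain e where e: "0 < e" "\<And>h. 0 < h \<Longrightarrow> h < e \<Longrightarrow> g J < g (J - h)"
      using DERIV_neg_dec_left[OF deriv, of J] by auto
    \<comment> \<open>Small enough for the local estimate, and \<open>J - h\<close> stays in the
      interval.\<close>
    define h where "h = min (e / 2) J"
    have "0 < h" "h < e" "h \<le> J" using e(1) that by (auto simp: h_def)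
    then show False using e(2)[of h] max[of "J - h"] J by force
  qed
  have right: "g' J \<le> 0" if "J < m"
  proof (rule ccontr)
    assume "\<not> g' J \<le> 0"
    then obtain e where e: "0 < e" "\<And>h. 0 < h \<Longrightarrow> h < e \<Longrightarrow> g J < g (J + h)"
      using DERIV_pos_inc_right[OF deriv, of J] by auto
    define h where "h = min (e / 2) (m - J)"
    have "0 < h" "h < e" "h \<le> m - J" using e(1) that by (auto simp: h_def)
    then show False using e(2)[of h] max[of "J + h"] J by force
  qed
  have pos: "0 < g' y" if "0 \<le> y" "y < J" for y
    using decr[of y J] left that by force
  have neg: "g' y < 0" if "J < y" "y \<le> m" for y
    using decr[of J y] right that J by force
  show "strict_mono_on {0..J} g"
  proof (rule strict_mono_onI)
    fix x y assume xy: "x \<in> {0..J}" "y \<in> {0..J}" "x < y"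
    show "g x < g y"
    proof (rule DERIV_pos_imp_increasing_open[OF xy(3)])
      show "\<exists>D. (g has_real_derivative D) (at z) \<and> 0 < D" if "x < z" "z < y" for z
        using deriv pos[of z] that xy by force
    qed (rule cont)
  qed
  show "strict_antimono_on {J..m} g"
  proof (rule monotone_onI)
    fix x y assume xy: "x \<in> {J..m}" "y \<in> {J..m}" "x < y"
    show "g y < g x"
    proof (rule DERIV_neg_imp_decreasing_open[OF xy(3)])
      show "\<exists>D. (g has_real_derivative D) (at z) \<and> D < 0" if "x < z" "z < y" for z
        using deriv neg[of z] that xy by force
    qed (rule cont)
  qed
  have "strict_antimono_on {0..J} g'"
  proof (rule monotone_onI)
    fix x y assume xy: "x \<in> {0..J}" "y \<in> {0..J}" "x < y"
    \<comment> \<open>If \<open>y = J\<close>, then \<open>x < y\<close> ensures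
      \<open>0 < J\<close>, so \<open>left\<close> applies.\<close>
    have "0 \<le> g' y" using pos[of y] left xy by (cases "y = J") auto
    then show "g' y < g' x" using decr[of x y] xy by simp
  qed
  then show "strictly_concave_on {0..J} g"
    by (rule strictly_concave_on_if_deriv_decreasing[OF deriv])
qed

section \<open>The derivative of the node reward\<close>

lemma exp_times_one_minus_less:
  fixes u v :: real
  assumes "0 \<le> u" "u < v"
  shows "exp v * (1 - v) < exp u * (1 - u)"
proof (rule DERIV_neg_imp_decreasing_open[OF \<open>u < v\<close>])
  show "\<exists>D. ((\<lambda>x. exp x * (1 - x)) has_real_derivative D) (at z) \<and> D < 0" if "u < z" "z < v" for z
  proof (intro exI conjI)
    show "((\<lambda>x. exp x * (1 - x)) has_real_derivative - z * exp z) (at z)"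
      by (auto intro!: derivative_eq_intros simp: algebra_simps)
  qed (use assms that in auto)
qed (intro continuous_intros)

text \<open>The quotient rule applied to \<open>y / (a + b * exp (s * y)) - q * y\<close>. Setting
  it to zero, with \<open>q = lam * c\<close>, gives the root equation for the uncapped one-sided
  load.\<close>

definition marginal_reward :: "real \<Rightarrow> real \<Rightarrow> real \<Rightarrow> real \<Rightarrow> real \<Rightarrow> real" where
  "marginal_reward a b s q y =
    (a + b * (exp (s * y) * (1 - s * y))) / (a + b * exp (s * y))\<^sup>2 - q"

lemma DERIV_node_reward:
  assumes "r > 0" "f > 0" "d > 0"
  shows "(node_reward lam r f d c has_real_derivative
    marginal_reward (1 / r) (1 / (f * (1 + d))) (ln (1 + d)) (lam * c) y) (at y)"
proof -
  define a b s where "a = 1 / r" and "b = 1 / (f * (1 + d))" and "s = ln (1 + d)"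
  have "a > 0" "b > 0" using assms by (simp_all add: a_def b_def)
  \<comment> \<open>The factor \<open>1 + d\<close> in the denominator of \<open>b\<close> absorbs
    the \<open>- 1\<close> of the exponent.\<close>
  have "(1 + d) powr (z - 1) / f = b * exp (s * z)" for z
    using assms by (simp add: powr_def b_def s_def left_diff_distrib exp_diff mult.commute)
  then have eq: "node_reward lam r f d c = (\<lambda>z. z / (a + b * exp (s * z)) - lam * z * c)"
    by (simp add: fun_eq_iff node_reward_def a_def)
  have "a + b * exp (s * y) > 0" using \<open>a > 0\<close> \<open>b > 0\<close> by (simp add: add_pos_pos)
  then show ?thesis
    unfolding a_def[symmetric] b_def[symmetric] s_def[symmetric] eq marginal_reward_def
    by (auto intro!: derivative_eq_intros simp: power2_eq_square field_simps)
qed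

text \<open>A nonnegative value at \<open>x\<close> together with \<open>q \<ge> 0\<close> makes the
  numerator \<open>N x\<close> nonnegative. Only with this sign does shrinking the denominator from
  \<open>D x\<close> to \<open>D y\<close> push the quotient upwards.\<close>

lemma marginal_reward_less:
  assumes "a > 0" "b > 0" "s > 0" "q \<ge> 0"
    and "0 \<le> y" "y < x" "0 \<le> marginal_reward a b s q x"
  shows "marginal_reward a b s q x < marginal_reward a b s q y"
proof -
  define N D where "N = (\<lambda>z. a + b * (exp (s * z) * (1 - s * z)))" and "D = (\<lambda>z. a + b * exp (s * z))"
  have M: "marginal_reward a b s q z = N z / (D z)\<^sup>2 - q" for z
    by (simp add: marginal_reward_def N_def D_def)
  have Dpos: "D z > 0" for z using assms by (simp add: D_def add_pos_pos)
  have "0 \<le> N x / (D x)\<^sup>2" using assms by (simp add: M)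
  then have "0 \<le> N x" using Dpos[of x] by (simp add: zero_le_divide_iff)
  have "N x < N y"
    using exp_times_one_minus_less[of "s * y" "s * x"] assms by (simp add: N_def)
  have "D y < D x"
    using assms by (simp add: D_def)
  then have "N x / (D x)\<^sup>2 \<le> N x / (D y)\<^sup>2"
    using \<open>0 \<le> N x\<close> Dpos[of x] Dpos[of y] by (intro divide_left_mono) auto
  also have "\<dots> < N y / (D y)\<^sup>2"
    using \<open>N x < N y\<close> Dpos[of y] by (intro divide_strict_right_mono) auto
  finally show ?thesis by (simp add: M)
qed

text \<open>Isolates the shape of the rewards from their formula: the load distribution argument
  uses only a peak \<open>J n\<close> with strict monotonicity on both sides, continuity, and
  concavity up to the peak.\<close>

locale unimodal_rewards =
  fixes G :: "'n::finite \<Rightarrow> real \<Rightarrow> real" and M :: "'n \<Rightarrow> nat" and J :: "'n \<Rightarrow> real"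
  assumes J_range: "0 \<le> J n" "J n \<le> real (M n)"
    and continuous_reward: "continuous_on {0..real (M n)} (G n)"
    and increasing: "strict_mono_on {0..J n} (G n)"
    and decreasing: "strict_antimono_on {J n..real (M n)} (G n)"
    and concave: "strictly_concave_on {0..J n} (G n)"
begin

section \<open>Comparison with the vector of peaks\<close>

lemma reward_less_left: "0 \<le> x \<Longrightarrow> x < y \<Longrightarrow> y \<le> J n \<Longrightarrow> G n x < G n y"
  by (rule strict_mono_onD[OF increasing]) auto

lemma reward_less_right: "J n \<le> x \<Longrightarrow> x < y \<Longrightarrow> y \<le> real (M n) \<Longrightarrow> G n y < G n x"
  using monotone_onD[OF decreasing, of x n y] by auto

lemma reward_less_peak:
  assumes "0 \<le> y" "y \<le> real (M n)" "y \<noteq> J n"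
  shows "G n y < G n (J n)"
  using assms reward_less_left[of y "J n" n] reward_less_right[of n "J n" y] by linarith

text \<open>The peaks maximize every summand separately. As the total \<open>K\<close> is arbitrary,
  this serves both the optimum at the total of the peaks and the comparison with larger
  totals.\<close>

lemma objective_less_peak:
  assumes "y \<in> feasible M K" "y $ m \<noteq> J m"
  shows "objective G y < objective G (\<chi> n. J n)"
  unfolding objective_def
proof (rule sum_strict_mono_ex1)
  have box: "0 \<le> y $ n" "y $ n \<le> real (M n)" for n
    using assms by (auto simp: feasible_def)
  show "\<forall>n\<in>UNIV. G n (y $ n) \<le> G n ((\<chi> n. J n) $ n)"
    using reward_less_peak[OF box] by (metis order.refl order.strict_implies_order vec_lambda_beta)
  show "\<exists>n\<in>UNIV. G n (y $ n) < G n ((\<chi> n. J n) $ n)"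
    using reward_less_peak[OF box assms(2)] by auto
qed simp

lemma peak_feasible: "(\<chi> n. J n) \<in> feasible M (\<Sum>n\<in>UNIV. J n)"
  using J_range by (simp add: feasible_def)

lemma optimal_solution_peak_iff:
  "optimal_solution G M (\<Sum>n\<in>UNIV. J n) y \<longleftrightarrow> (\<forall>n. y $ n = J n)"
proof
  assume "optimal_solution G M (\<Sum>n\<in>UNIV. J n) y"
  then show "\<forall>n. y $ n = J n"
    using objective_less_peak peak_feasible
    unfolding optimal_solution_def is_arg_max_def by blast
next
  assume "\<forall>n. y $ n = J n"
  then have y: "y = (\<chi> n. J n)" by (simp add: vec_eq_iff)
  have "\<not> objective G y < objective G z" if "z \<in> feasible M (\<Sum>n\<in>UNIV. J n)" for z
  proof (cases "z = y")
    case False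
    then obtain m where "z $ m \<noteq> J m" by (auto simp: y vec_eq_iff)
    then show ?thesis using objective_less_peak[OF that] by (force simp: y)
  qed simp
  then show "optimal_solution G M (\<Sum>n\<in>UNIV. J n) y"
    using peak_feasible by (simp add: optimal_solution_def is_arg_max_def y)
qed

section \<open>Existence of optimal solutions\<close>

lemma feasible_nonempty:
  assumes "0 \<le> K" "K \<le> (\<Sum>n\<in>UNIV. real (M n))"
  shows "feasible M K \<noteq> {}"
\<comment> \<open>The witness for \<open>K \<noteq> 0\<close> divides by the total capacity, which
  is then positive but may vanish when \<open>K = 0\<close>.\<close>
proof (cases "K = 0")
  case True
  then have "0 \<in> feasible M K" by (simp add: feasible_def)
  then show ?thesis by blast
next
  case False
  define S where "S = (\<Sum>n\<in>UNIV. real (M n))"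
  have "0 < S" "K \<le> S" using assms False by (simp_all add: S_def)
  then have "K / S \<le> 1" "0 \<le> K / S" using assms by simp_all
  \<comment> \<open>Every node is filled to the same fraction of its capacity.\<close>
  then have "(\<chi> n. K / S * real (M n)) \<in> feasible M K"
    using \<open>0 < S\<close>
    by (auto simp: feasible_def mult_left_le_one_le simp del: times_divide_eq_left
        simp flip: sum_distrib_left S_def) simp
  then show ?thesis by blast
qed

lemma compact_feasible: "compact (feasible M K)"
proof -
  have "feasible M K = {y. (\<Sum>n\<in>UNIV. y $ n) = K} \<inter> cbox 0 (\<chi> n. real (M n))"
    by (auto simp: feasible_def mem_box_cart)
  moreover have "closed {y::real^'n. (\<Sum>n\<in>UNIV. y $ n) = K}"
    by (intro closed_Collect_eq continuous_intros)
  ultimately show ?thesis by (simp add: closed_Int_compact)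
qed

lemma continuous_on_objective: "continuous_on (feasible M K) (objective G)"
proof -
  have "continuous_on (feasible M K) (\<lambda>y. G n (y $ n))" for n
    by (rule continuous_on_compose2[OF continuous_reward])
      (auto simp: feasible_def intro!: continuous_intros)
  then show ?thesis
    unfolding objective_def by (intro continuous_intros)
qed

text \<open>A continuous objective on a nonempty compact set. This makes the supremum in
  \<open>optimal_value\<close> a maximum, to be evaluated by
  \<open>optimal_value_eq\<close>.\<close>

lemma optimal_solution_exists:
  assumes "0 \<le> K" "K \<le> (\<Sum>n\<in>UNIV. real (M n))"
  obtains y where "optimal_solution G M K y"
  using continuous_attains_sup[OF compact_feasible feasible_nonempty[OF assms] continuous_on_objective]
  unfolding optimal_solution_def is_arg_max_def by (metis not_less)

section \<open>The exchange argument\<close>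

lemma not_optimal_if_transfer:
  assumes y: "y \<in> feasible M K" and "0 < e" "j \<noteq> k"
    and "y $ j + e \<le> real (M j)" "0 \<le> y $ k - e"
    and gain: "G j (y $ j) < G j (y $ j + e)" "G k (y $ k) < G k (y $ k - e)"
  shows "\<not> optimal_solution G M K y"
proof -
  define z where "z = (\<chi> n. if n = j then y $ j + e else if n = k then y $ k - e else y $ n)"
  \<comment> \<open>In this additive form the two corrections cancel in the sum over all
    nodes.\<close>
  have "z $ n = y $ n + (if n = j then e else 0) - (if n = k then e else 0)" for n
    using \<open>j \<noteq> k\<close> by (simp add: z_def)
  then have "(\<Sum>n\<in>UNIV. z $ n) = (\<Sum>n\<in>UNIV. y $ n)"
    by (simp add: sum.distrib sum_subtractf)
  moreover have "0 \<le> z $ n \<and> z $ n \<le> real (M n)" for n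
  proof -
    have "0 \<le> y $ n" "y $ n \<le> real (M n)" "0 \<le> y $ j" "y $ k \<le> real (M k)"
      using y by (auto simp: feasible_def)
    then show ?thesis using assms(2,4,5) by (auto simp: z_def)
  qed
  ultimately have "z \<in> feasible M K" using y by (simp add: feasible_def)
  moreover have "objective G y < objective G z"
    unfolding objective_def
  proof (rule sum_strict_mono_ex1)
    show "\<forall>n\<in>UNIV. G n (y $ n) \<le> G n (z $ n)"
      using gain by (simp add: z_def less_imp_le)
    show "\<exists>n\<in>UNIV. G n (y $ n) < G n (z $ n)"
      using gain by (intro bexI[of _ j]) (simp_all add: z_def)
  qed simp
  ultimately show ?thesis
    by (auto simp: optimal_solution_def is_arg_max_def)
qed

text \<open>Moving load from a node above its peak to one below its peak would raise both
  rewards.\<close>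

lemma optimal_solution_same_side:
  assumes opt: "optimal_solution G M K y"
  shows "\<not> (y $ j < J j \<and> J k < y $ k)"
proof
  assume jk: "y $ j < J j \<and> J k < y $ k"
  have y: "y \<in> feasible M K"
    using opt by (simp add: optimal_solution_def is_arg_max_def)
  then have box: "0 \<le> y $ n" "y $ n \<le> real (M n)" for n
    by (auto simp: feasible_def)
  \<comment> \<open>The largest transfer for which neither node crosses its peak.\<close>
  define e where "e = min (J j - y $ j) (y $ k - J k)"
  have e: "0 < e" "y $ j + e \<le> J j" "J k \<le> y $ k - e"
    using jk by (auto simp: e_def)
  have "\<not> optimal_solution G M K y"
  proof (rule not_optimal_if_transfer[OF y \<open>0 < e\<close>])
    show "j \<noteq> k" using jk by auto
    show "y $ j + e \<le> real (M j)" using e J_range(2)[of j] by simp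
    show "0 \<le> y $ k - e" using e J_range(1)[of k] by simp
    show "G j (y $ j) < G j (y $ j + e)"
      using e box by (intro reward_less_left) auto
    show "G k (y $ k) < G k (y $ k - e)"
      using e box by (intro reward_less_right) auto
  qed
  with opt show False by simp
qed

text \<open>A total below that of the peaks leaves some node \<open>j\<close> under its peak, so by
  \<open>optimal_solution_same_side\<close> no node can be above its own.\<close>

lemma optimal_solution_le_peak:
  assumes opt: "optimal_solution G M K y" and "K < (\<Sum>n\<in>UNIV. J n)"
  shows "y $ m \<le> J m"
proof (rule ccontr)
  assume "\<not> y $ m \<le> J m"
  have "(\<Sum>n\<in>UNIV. y $ n) < (\<Sum>n\<in>UNIV. J n)"
    using assms by (simp add: optimal_solution_def is_arg_max_def feasible_def)
  then obtain j where "y $ j < J j"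
    by (meson not_le sum_mono)
  then show False
    using optimal_solution_same_side[OF opt, of j m] \<open>\<not> y $ m \<le> J m\<close> by simp
qed

lemma optimal_solution_ge_peak:
  assumes opt: "optimal_solution G M K y" and "(\<Sum>n\<in>UNIV. J n) < K"
  shows "J m \<le> y $ m"
proof (rule ccontr)
  assume "\<not> J m \<le> y $ m"
  have "(\<Sum>n\<in>UNIV. J n) < (\<Sum>n\<in>UNIV. y $ n)"
    using assms by (simp add: optimal_solution_def is_arg_max_def feasible_def)
  then obtain k where "J k < y $ k"
    by (meson not_le sum_mono)
  then show False
    using optimal_solution_same_side[OF opt, of m k] \<open>\<not> J m \<le> y $ m\<close> by simp
qed

section \<open>Concavity of the objective and growth of the optimal value\<close>

lemma strictly_concave_objective:
  "strictly_concave_on {y. \<forall>n. 0 \<le> y $ n \<and> y $ n \<le> J n} (objective G)"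
  unfolding strictly_concave_on_def
proof (intro conjI ballI impI allI)
  have "{y. \<forall>n. 0 \<le> y $ n \<and> y $ n \<le> J n} = cbox 0 (\<chi> n. J n)"
    by (auto simp: mem_box_cart)
  then show "convex {y. \<forall>n. 0 \<le> y $ n \<and> y $ n \<le> J n}" by simp
next
  fix x y :: "real^'n" and t :: real
  assume x: "x \<in> {y. \<forall>n. 0 \<le> y $ n \<and> y $ n \<le> J n}"
    and y: "y \<in> {y. \<forall>n. 0 \<le> y $ n \<and> y $ n \<le> J n}"
    and "x \<noteq> y" and t: "0 < t \<and> t < 1"
  let ?z = "(1 - t) *\<^sub>R x + t *\<^sub>R y"
  \<comment> \<open>Coordinates where \<open>x\<close> and \<open>y\<close> agree give equality, so
    strictness of the sum rests on one coordinate where they differ.\<close>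
  have strict: "(1 - t) * G n (x $ n) + t * G n (y $ n) < G n (?z $ n)" if "x $ n \<noteq> y $ n" for n
    using concave[of n] x y t that unfolding strictly_concave_on_def by auto
  have "(\<Sum>n\<in>UNIV. (1 - t) * G n (x $ n) + t * G n (y $ n)) < (\<Sum>n\<in>UNIV. G n (?z $ n))"
  proof (rule sum_strict_mono_ex1)
    show "\<forall>n\<in>UNIV. (1 - t) * G n (x $ n) + t * G n (y $ n) \<le> G n (?z $ n)"
    proof
      fix n
      show "(1 - t) * G n (x $ n) + t * G n (y $ n) \<le> G n (?z $ n)"
      proof (cases "x $ n = y $ n")
        case True
        then have "?z $ n = y $ n" by (simp add: algebra_simps)
        with True show ?thesis by (simp add: algebra_simps)
      next
        case False
        then show ?thesis using strict by (simp add: less_imp_le)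
      qed
    qed
    obtain n where "x $ n \<noteq> y $ n" using \<open>x \<noteq> y\<close> by (auto simp: vec_eq_iff)
    then show "\<exists>n\<in>UNIV. (1 - t) * G n (x $ n) + t * G n (y $ n) < G n (?z $ n)"
      using strict by blast
  qed simp
  then show "(1 - t) * objective G x + t * objective G y < objective G ?z"
    by (simp add: objective_def sum.distrib sum_distrib_left)
qed

lemma optimal_value_less:
  assumes "0 \<le> K" "K < K'" "K' \<le> (\<Sum>n\<in>UNIV. J n)"
  shows "optimal_value G M K < optimal_value G M K'"
proof -
  define S where "S = (\<Sum>n\<in>UNIV. J n)"
  have "S \<le> (\<Sum>n\<in>UNIV. real (M n))"
    unfolding S_def by (intro sum_mono J_range)
  then obtain y y' where y: "optimal_solution G M K y" and y': "optimal_solution G M K' y'"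
    using optimal_solution_exists[of K] optimal_solution_exists[of K'] assms
    by (metis S_def less_imp_le order_trans)
  have feas: "0 \<le> y $ n" "(\<Sum>n\<in>UNIV. y $ n) = K" for n
    using y by (auto simp: optimal_solution_def is_arg_max_def feasible_def)
  \<comment> \<open>Since \<open>K < K'\<close>, the total \<open>K\<close> lies strictly below that
    of the peaks, so all loads are in the range where the rewards increase.\<close>
  have le: "y $ n \<le> J n" for n
    using optimal_solution_le_peak[OF y] assms by simp
  \<comment> \<open>Moving from \<open>y\<close> towards \<open>J\<close> raises the total load to \<open>K'\<close> without decreasing any reward.\<close>
  define t where "t = (K' - K) / (S - K)"
  have t: "0 < t" "t \<le> 1" "t * (S - K) = K' - K"
    using assms by (simp_all add: t_def S_def)
  define z where "z = (\<chi> n. y $ n + t * (J n - y $ n))"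
  have z: "y $ n \<le> z $ n" "z $ n \<le> J n" for n
  proof -
    show "y $ n \<le> z $ n" using t le[of n] by (simp add: z_def)
    show "z $ n \<le> J n"
      using mult_right_mono[of t 1 "J n - y $ n"] t le[of n] by (simp add: z_def)
  qed
  have "(\<Sum>n\<in>UNIV. z $ n) = K + t * (S - K)"
    by (simp add: z_def sum.distrib sum_subtractf feas S_def flip: sum_distrib_left)
  then have sum_z: "(\<Sum>n\<in>UNIV. z $ n) = K'" using t by simp
  have "z \<in> feasible M K'"
    using sum_z z feas J_range unfolding feasible_def by (blast intro: order_trans)
  then have "objective G z \<le> objective G y'"
    using y' by (auto simp: optimal_solution_def is_arg_max_def not_less)
  moreover have "objective G y < objective G z"
    unfolding objective_def
  proof (rule sum_strict_mono_ex1)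
    show "\<forall>n\<in>UNIV. G n (y $ n) \<le> G n (z $ n)"
      using reward_less_left[OF feas(1) _ z(2)] z(1) by (metis order.order_iff_strict)
    \<comment> \<open>The larger total forces a strict increase in some coordinate.\<close>
    have "(\<Sum>n\<in>UNIV. y $ n) < (\<Sum>n\<in>UNIV. z $ n)"
      using assms by (simp add: feas sum_z)
    then obtain n where "y $ n < z $ n" by (meson not_le sum_mono)
    then show "\<exists>n\<in>UNIV. G n (y $ n) < G n (z $ n)"
      using reward_less_left[OF feas(1) _ z(2)] by blast
  qed simp
  ultimately show ?thesis
    by (simp add: optimal_value_eq[OF y] optimal_value_eq[OF y'])
qed

text \<open>A load whose total differs from that of the peaks misses some peak, so
  \<open>objective_less_peak\<close> applies to an optimal load for \<open>K\<close>.\<close>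

lemma optimal_value_less_peak:
  assumes "(\<Sum>n\<in>UNIV. J n) < K" "K \<le> (\<Sum>n\<in>UNIV. real (M n))"
  shows "optimal_value G M K < optimal_value G M (\<Sum>n\<in>UNIV. J n)"
proof -
  have "0 \<le> K" using assms(1) sum_nonneg[of UNIV J] J_range(1) by simp
  then obtain y where y: "optimal_solution G M K y"
    using optimal_solution_exists assms(2) by blast
  have peak: "optimal_solution G M (\<Sum>n\<in>UNIV. J n) (\<chi> n. J n)"
    by (simp add: optimal_solution_peak_iff)
  have feas: "y \<in> feasible M K"
    using y by (simp add: optimal_solution_def is_arg_max_def)
  then have "(\<Sum>n\<in>UNIV. y $ n) \<noteq> (\<Sum>n\<in>UNIV. J n)"
    using assms by (simp add: feasible_def)
  then obtain m where "y $ m \<noteq> J m" by (meson sum.cong)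
  then show ?thesis
    using objective_less_peak[OF feas]
    by (simp add: optimal_value_eq[OF y] optimal_value_eq[OF peak])
qed

end

section \<open>Unimodality of the node rewards and the four properties\<close>

lemma unimodal_rewards_node_reward:
  fixes r f d c :: "'n::finite \<Rightarrow> real"
  assumes "\<And>n. r n > 0" "\<And>n. f n > 0" "\<And>n. d n > 0" "\<And>n. c n \<ge> 0" "lam \<ge> 0"
    and G_eq: "G = (\<lambda>n. node_reward lam (r n) (f n) (d n) (c n))"
  shows "unimodal_rewards G M (one_sided_load G M)"
proof -
  define g' where
    "g' n = marginal_reward (1 / r n) (1 / (f n * (1 + d n))) (ln (1 + d n)) (lam * c n)" for n
  have deriv: "(G n has_real_derivative g' n y) (at y)" for n y
    unfolding G_eq g'_def using assms by (intro DERIV_node_reward) auto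
  have decr: "g' n x < g' n y" if "0 \<le> y" "y < x" "0 \<le> g' n x" for n x y
    using that assms(1-4)[of n] \<open>lam \<ge> 0\<close> unfolding g'_def
    by (intro marginal_reward_less) (simp_all add: add_pos_pos)
  have cont: "continuous_on {0..real (M n)} (G n)" for n
    using deriv by (meson DERIV_isCont continuous_at_imp_continuous_on)
  \<comment> \<open>\<open>arg_max_on\<close> is a choice operator, so the existence of a maximizer
    must be shown before \<open>one_sided_load\<close> is known to be one.\<close>
  have "is_arg_max (G n) (\<lambda>x. x \<in> {0..real (M n)}) (one_sided_load G M n)" for n
  proof -
    have "\<exists>x. is_arg_max (G n) (\<lambda>x. x \<in> {0..real (M n)}) x"
      using continuous_attains_sup[OF compact_Icc _ cont]
      unfolding is_arg_max_def by (fastforce simp: not_less)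
    then show ?thesis
      unfolding one_sided_load_def arg_max_on_def arg_max_def by (rule someI_ex)
  qed
  then have J: "one_sided_load G M n \<in> {0..real (M n)}"
    and max: "y \<in> {0..real (M n)} \<Longrightarrow> G n y \<le> G n (one_sided_load G M n)" for n y
    unfolding is_arg_max_def by (auto simp: not_less)
  show ?thesis
    using J cont unimodal_at_maximizer[OF deriv decr J max]
    by unfold_locales auto
qed

text \<open>The equivalence for \<open>K = Kstar\<close> expresses both optimality and uniqueness of
  the peak load. Totals are bounded by the total capacity because beyond it the feasible set is
  empty and the supremum carries no meaning.\<close>

theorem proposition2:
  fixes r f d c :: "'n::finite \<Rightarrow> real" and lam :: real and M :: "'n \<Rightarrow> nat" and n0 :: 'n
  fixes G :: "'n \<Rightarrow> real \<Rightarrow> real" and J :: "'n \<Rightarrow> real" and Kstar :: real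
  assumes "\<And>n. r n > 0" and "\<And>n. f n > 0" and "\<And>n. d n > 0" and "\<And>n. c n \<ge> 0"
    and "c n0 = 0" and "lam \<ge> 0" and "\<And>n. M n > 0"
  assumes G_eq: "G = (\<lambda>n. node_reward lam (r n) (f n) (d n) (c n))"
    and J_eq: "J = one_sided_load G M"
    and Kstar_eq: "Kstar = (\<Sum>n\<in>UNIV. J n)"
  shows
    "(\<forall>K. 0 \<le> K \<and> K \<le> (\<Sum>n\<in>UNIV. real (M n)) \<longrightarrow>
        (K = Kstar \<longrightarrow> (\<forall>y. optimal_solution G M K y \<longleftrightarrow> (\<forall>n. y $ n = J n))) \<and>
        (K < Kstar \<longrightarrow>
           (\<forall>y. optimal_solution G M K y \<longrightarrow> (\<forall>n. y $ n \<le> J n)) \<and>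
           strictly_concave_on {y. \<forall>n. 0 \<le> y $ n \<and> y $ n \<le> J n} (objective G)) \<and>
        (K > Kstar \<longrightarrow> (\<forall>y. optimal_solution G M K y \<longrightarrow> (\<forall>n. y $ n \<ge> J n)))) \<and>
     strict_mono_on {0..Kstar} (optimal_value G M) \<and>
     (\<forall>K. Kstar < K \<and> K \<le> (\<Sum>n\<in>UNIV. real (M n)) \<longrightarrow>
        optimal_value G M Kstar > optimal_value G M K)"
proof -
  interpret unimodal_rewards G M J
    unfolding J_eq by (rule unimodal_rewards_node_reward) (use assms in auto)
  have "strict_mono_on {0..Kstar} (optimal_value G M)"
    by (rule strict_mono_onI) (use optimal_value_less Kstar_eq in auto)
  then show ?thesis
    using optimal_solution_peak_iff optimal_solution_le_peak optimal_solution_ge_peak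
      strictly_concave_objective optimal_value_less_peak
    unfolding Kstar_eq by blast
qed

end
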